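(* For every $n\ge1$, the number of $1$-almost-increasing permutations in $S_n$ equals the number of evil-avoiding permutations in $S_n$.
   Context: A permutation $\pi\in S_n$ (one-line form) is $1$-almost-increasing if for every $i\in\{1,\dots,n\}$ there is at most one $j\le i$ with $\pi_j>i$; equivalently, $\pi$ avoids $4321,4312,3421,3412$. A permutation is evil-avoiding if it avoids $2413,4132,4213,3214$. *)

theory Defs
  imports "HOL-Combinatorics.Combinatorics"
begin

definition perms :: "nat \<Rightarrow> (nat \<Rightarrow> nat) set" where
  "perms n = {p. p permutes {1..n}}"

definition contains_pattern :: "nat \<Rightarrow> (nat \<Rightarrow> nat) \<Rightarrow> nat list \<Rightarrow> bool" where
  "contains_pattern n p pat \<longleftrightarrow>
     (\<exists>idx :: nat \<Rightarrow> nat.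
        strict_mono_on {..<length pat} idx \<and>
        idx ` {..<length pat} \<subseteq> {1..n} \<and>
        (\<forall>a<length pat. \<forall>b<length pat. p (idx a) < p (idx b) \<longleftrightarrow> pat ! a < pat ! b))"

definition avoids :: "nat \<Rightarrow> (nat \<Rightarrow> nat) \<Rightarrow> nat list \<Rightarrow> bool" where
  "avoids n p pat \<longleftrightarrow> \<not> contains_pattern n p pat"

definition one_almost_increasing :: "nat \<Rightarrow> (nat \<Rightarrow> nat) \<Rightarrow> bool" where
  "one_almost_increasing n p \<longleftrightarrow>
     (\<forall>i\<in>{1..n}. card {j \<in> {1..i}. p j > i} \<le> 1)"

definition evil_avoiding :: "nat \<Rightarrow> (nat \<Rightarrow> nat) \<Rightarrow> bool" where
  "evil_avoiding n p \<longleftrightarrow>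
     avoids n p [2,4,1,3] \<and> avoids n p [4,1,3,2] \<and> avoids n p [4,2,1,3] \<and> avoids n p [3,2,1,4]"

end

theory Submission
  imports Defs "HOL-Library.Sublist"
begin

text \<open>Both counting sequences satisfy \<open>u\<^sub>0 = u\<^sub>1 = 1\<close> and \<open>u\<^sub>n\<^sub>+\<^sub>1 + 2 u\<^sub>n\<^sub>-\<^sub>1 = 4 u\<^sub>n\<close>.

  Let \<open>B\<^sub>n\<close> be the set of 1-almost-increasing permutations and \<open>s = (n n+1)\<close>. Multiplying by \<open>s\<close> on
  either side preserves \<open>B\<^sub>n\<^sub>+\<^sub>1\<close>, and every element of \<open>B\<^sub>n\<^sub>+\<^sub>1\<close> has exactly one of the forms \<open>q\<close>,
  \<open>q s\<close>, or \<open>s q\<close>, \<open>s q s\<close> with \<open>q n \<noteq> n\<close>, where \<open>q \<in> B\<^sub>n\<close>.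

  Write evil-avoiding permutations as words in the letters \<open>0, \<dots>, n-1\<close>, and let \<open>a\<^sub>n\<close> be their
  number and \<open>x\<^sub>n\<close> the number of those words \<open>P 0 Q\<close> in which \<open>P\<close> and \<open>Q\<close> are nonempty. A minimum may
  always be put first or last, so \<open>a\<^sub>n\<^sub>+\<^sub>1 = 2 a\<^sub>n + x\<^sub>n\<^sub>+\<^sub>1\<close>. Moreover \<open>x\<^sub>n\<^sub>+\<^sub>1 = x\<^sub>n + a\<^sub>n\<close>: if \<open>P\<close> has at least two
  letters and starts with its smallest one, delete that letter (it is one less than the smallest
  remaining letter of \<open>P\<close>, so it can be recovered); otherwise delete \<open>0\<close>, whose position is forced.\<close>

section \<open>Almost increasing permutations\<close>

definition almost_increasing_perms :: "nat \<Rightarrow> (nat \<Rightarrow> nat) set" where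
  "almost_increasing_perms n = {p \<in> perms n. one_almost_increasing n p}"

lemma finite_perms: "finite (perms n)"
  unfolding perms_def by (simp add: finite_permutations)

text \<open>\<open>Suc n\<close> is the only available value above \<open>n\<close>, and injectivity
  lets it occur only once.\<close>

lemma crossing_card_le_1:
  assumes "p permutes {1..Suc n}"
  shows "card {j \<in> {1..n}. p j > n} \<le> 1"
proof -
  have "x = y" if "x \<in> {j \<in> {1..n}. p j > n}" "y \<in> {j \<in> {1..n}. p j > n}" for x y
  proof -
    have "p x \<in> {1..Suc n}" "p y \<in> {1..Suc n}"
      using that by (simp_all only: permutes_in_image[OF assms]) auto
    then have "p x = p y" using that by auto
    then show ?thesis using permutes_inj[OF assms] by (simp add: inj_eq)
  qed
  then show ?thesis
    unfolding One_nat_def by (subst card_le_Suc0_iff_eq) (simp, blast)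
qed

lemma no_crossing_at_top:
  fixes n :: nat
  assumes "p permutes {1..n}"
  shows "{j \<in> {1..n}. p j > n} = {}"
proof -
  have "\<not> n < p j" if "j \<in> {1..n}" for j
    using that permutes_in_image[OF assms, of j] by auto
  then show ?thesis by blast
qed

text \<open>The cuts \<open>i = n\<close> and \<open>i = Suc n\<close> are harmless for every
  permutation of \<open>{1..Suc n}\<close>. The remaining cuts \<open>i < n\<close> cannot tell
  \<open>n\<close> from \<open>Suc n\<close>, either as positions or as values.\<close>

lemma one_almost_increasing_Suc_iff:
  assumes "p permutes {1..Suc n}"
  shows "one_almost_increasing (Suc n) p \<longleftrightarrow> (\<forall>i\<in>{1..<n}. card {j \<in> {1..i}. p j > i} \<le> 1)"
proof
  assume r: "\<forall>i\<in>{1..<n}. card {j \<in> {1..i}. p j > i} \<le> 1"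
  show "one_almost_increasing (Suc n) p"
    unfolding one_almost_increasing_def
  proof
    fix i assume "i \<in> {1..Suc n}"
    then consider "i \<in> {1..<n}" | "i = n" | "i = Suc n" by fastforce
    then show "card {j \<in> {1..i}. p j > i} \<le> 1"
    proof cases
      case 3
      then show ?thesis by (simp only: no_crossing_at_top[OF assms] card.empty)
    qed (use r crossing_card_le_1[OF assms] in auto)
  qed
qed (auto simp: one_almost_increasing_def)

lemma one_almost_increasing_extend:
  assumes "p permutes {1..n}"
  shows "one_almost_increasing (Suc n) p \<longleftrightarrow> one_almost_increasing n p"
proof -
  have "p permutes {1..Suc n}"
    using assms by (rule permutes_subset) auto
  then have "card {j \<in> {1..Suc n}. p j > Suc n} \<le> 1"
    by (simp only: no_crossing_at_top card.empty)
  moreover have "(\<forall>i\<in>{1..Suc n}. P i) \<longleftrightarrow> P (Suc n) \<and> (\<forall>i\<in>{1..n}. P i)" for P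
    by (simp add: atLeastAtMostSuc_conv)
  ultimately show ?thesis
    by (simp only: one_almost_increasing_def simp_thms)
qed

section \<open>Swapping the two top positions or the two top values\<close>

lemma transpose_top_permutes:
  assumes "n \<ge> 1"
  shows "transpose n (Suc n) permutes {1..Suc n}"
  using assms by (intro permutes_swap_id) auto

text \<open>A cut \<open>i < n\<close> only looks at positions that the transposition fixes.\<close>

lemma one_almost_increasing_comp_transpose:
  assumes "n \<ge> 1" "p permutes {1..Suc n}"
  shows "one_almost_increasing (Suc n) (p \<circ> transpose n (Suc n)) \<longleftrightarrow> one_almost_increasing (Suc n) p"
proof -
  have "{j \<in> {1..i}. (p \<circ> transpose n (Suc n)) j > i} = {j \<in> {1..i}. p j > i}" if "i < n" for i
    using that by (auto simp: transpose_def)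
  then show ?thesis
    using assms transpose_top_permutes
    by (simp add: one_almost_increasing_Suc_iff permutes_compose)
qed

text \<open>For \<open>i < n\<close> both \<open>n\<close> and \<open>Suc n\<close> exceed
  \<open>i\<close>, so exchanging these values leaves the crossing set at \<open>i\<close>
  unchanged.\<close>

lemma one_almost_increasing_transpose_comp:
  assumes "n \<ge> 1" "p permutes {1..Suc n}"
  shows "one_almost_increasing (Suc n) (transpose n (Suc n) \<circ> p) \<longleftrightarrow> one_almost_increasing (Suc n) p"
proof -
  have "{j \<in> {1..i}. (transpose n (Suc n) \<circ> p) j > i} = {j \<in> {1..i}. p j > i}" if "i < n" for i
    using that by (auto simp: transpose_def split: if_splits)
  then show ?thesis
    using assms transpose_top_permutes
    by (simp add: one_almost_increasing_Suc_iff permutes_compose)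
qed

lemma almost_increasing_perms_comp_transpose:
  assumes "n \<ge> 1" "p \<in> almost_increasing_perms (Suc n)"
  shows "p \<circ> transpose n (Suc n) \<in> almost_increasing_perms (Suc n)"
    and "transpose n (Suc n) \<circ> p \<in> almost_increasing_perms (Suc n)"
  using assms transpose_top_permutes
  by (simp_all add: almost_increasing_perms_def perms_def permutes_compose
      one_almost_increasing_comp_transpose one_almost_increasing_transpose_comp)

text \<open>Permutations are functions on all of \<open>nat\<close> that are the identity outside
  their carrier, so the families for successive \<open>n\<close> are nested.\<close>

lemma almost_increasing_perms_eq_fixing_top:
  "almost_increasing_perms n = {p \<in> almost_increasing_perms (Suc n). p (Suc n) = Suc n}"
proof -
  have *: "p permutes {1..n} \<longleftrightarrow> p permutes {1..Suc n} \<and> p (Suc n) = Suc n" for p :: "nat \<Rightarrow> nat"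
  proof
    assume "p permutes {1..Suc n} \<and> p (Suc n) = Suc n"
    then show "p permutes {1..n}"
      by (elim conjE permutes_superset) (auto simp: le_Suc_eq)
  next
    assume "p permutes {1..n}"
    then show "p permutes {1..Suc n} \<and> p (Suc n) = Suc n"
      using permutes_subset[of p "{1..n}" "{1..Suc n}"] by (simp add: permutes_not_in)
  qed
  show ?thesis
  proof (intro set_eqI iffI)
    fix p
    assume "p \<in> almost_increasing_perms n"
    then show "p \<in> {p \<in> almost_increasing_perms (Suc n). p (Suc n) = Suc n}"
      using *[of p] one_almost_increasing_extend[of p n]
      by (simp add: almost_increasing_perms_def perms_def)
  next
    fix p
    assume "p \<in> {p \<in> almost_increasing_perms (Suc n). p (Suc n) = Suc n}"
    then show "p \<in> almost_increasing_perms n"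
      using *[of p] one_almost_increasing_extend[of p n]
      by (simp add: almost_increasing_perms_def perms_def)
  qed
qed

text \<open>Otherwise the values \<open>n\<close> and \<open>Suc n\<close> both sit at positions
  below \<open>n\<close>, which gives two crossings of the cut \<open>n - 1\<close>.\<close>

lemma almost_increasing_top_cases:
  assumes "p \<in> almost_increasing_perms (Suc n)" "n \<ge> 1"
  shows "p (Suc n) = Suc n \<or> p n = Suc n \<or> p (Suc n) = n \<or> p n = n"
proof (rule ccontr)
  assume neg: "\<not> ?thesis"
  have p: "p permutes {1..Suc n}" and ai: "one_almost_increasing (Suc n) p"
    using assms by (auto simp: almost_increasing_perms_def perms_def)
  obtain k l where kl: "p k = Suc n" "p l = n"
    using permutes_surj[OF p] by (metis surjD)
  have "k \<in> {1..Suc n}" "l \<in> {1..Suc n}"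
    using kl permutes_in_image[OF p, of k] permutes_in_image[OF p, of l] assms(2) by auto
  moreover have "k \<noteq> n" "k \<noteq> Suc n" "l \<noteq> n" "l \<noteq> Suc n"
    using neg kl by auto
  ultimately have kl': "k \<in> {1..n - 1}" "l \<in> {1..n - 1}"
    by auto
  then have "{k, l} \<subseteq> {j \<in> {1..n - 1}. p j > n - 1}"
    using kl assms(2) by auto
  then have "card {k, l} \<le> card {j \<in> {1..n - 1}. p j > n - 1}"
    by (intro card_mono) auto
  also have "\<dots> \<le> 1"
    using ai kl' by (auto simp: one_almost_increasing_def)
  finally show False using kl by (auto simp: card_insert_if split: if_splits)
qed

text \<open>The pieces \<open>B\<close>, \<open>?G\<close>, \<open>?H\<close>, \<open>?I\<close> of
  \<open>A\<close> have sizes \<open>card B\<close>, \<open>card B\<close>, \<open>card C\<close>,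
  \<open>card C\<close>. The elements of \<open>B\<close> missing from \<open>C\<close> fix
  \<open>n\<close> as well, so they form \<open>almost_increasing_perms m\<close>; this is where the
  subtracted term comes from.\<close>

lemma card_almost_increasing_perms_rec:
  "card (almost_increasing_perms (Suc (Suc m))) + 2 * card (almost_increasing_perms m)
     = 4 * card (almost_increasing_perms (Suc m))"
proof -
  define n where "n = Suc m"
  define s where "s = transpose n (Suc n)"
  define A where "A = almost_increasing_perms (Suc n)"
  define B where "B = almost_increasing_perms n"
  \<comment> \<open>If \<open>q\<close> fixes both \<open>n\<close> and \<open>Suc n\<close>, it
    commutes with \<open>s\<close>. Then \<open>s \<circ> q\<close> equals
    \<open>q \<circ> s\<close> and \<open>s \<circ> q \<circ> s\<close> equals \<open>q\<close>, so
    such \<open>q\<close> would be counted twice.\<close>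
  define C where "C = {q \<in> B. q n \<noteq> n}"
  have n1: "n \<ge> 1" by (simp add: n_def)
  have s: "s n = Suc n" "s (Suc n) = n" "s \<circ> s = id"
    by (auto simp: s_def transpose_comp_involutory)
  have ss: "s (s x) = x" for x using s(3) by (metis comp_apply id_apply)
  have sx: "s x = n \<longleftrightarrow> x = Suc n" "s x = Suc n \<longleftrightarrow> x = n" for x
    using ss s by metis+
  have injs: "inj_on (\<lambda>q. q \<circ> s) X" "inj_on (\<lambda>q. s \<circ> q) X" "inj_on (\<lambda>q. s \<circ> q \<circ> s) X" for X
    using ss by (auto intro!: inj_onI simp: fun_eq_iff) metis+
  have closed: "q \<circ> s \<in> A" "s \<circ> q \<in> A" if "q \<in> A" for q
    using almost_increasing_perms_comp_transpose[OF n1] that by (auto simp: A_def s_def)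
  have inA: "q \<in> B \<longleftrightarrow> q \<in> A \<and> q (Suc n) = Suc n" for q
    using almost_increasing_perms_eq_fixing_top[of n] by (auto simp: A_def B_def)
  have inj_q: "q n \<noteq> q (Suc n)" if "q \<in> A" for q
    using that permutes_inj[of q] by (auto simp: A_def almost_increasing_perms_def perms_def inj_eq)
  have fin: "finite A" "finite B" "finite C"
    using finite_perms by (auto simp: A_def B_def C_def almost_increasing_perms_def)
  have S1: "(\<lambda>q. q \<circ> s) ` B = {p \<in> A. p n = Suc n}" (is "_ = ?G")
  proof (intro set_eqI iffI)
    fix p assume "p \<in> ?G"
    then have "p \<circ> s \<in> B" "p = p \<circ> s \<circ> s" using closed s by (auto simp: inA comp_assoc)
    then show "p \<in> (\<lambda>q. q \<circ> s) ` B" by blast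
  qed (use closed s in \<open>auto simp: inA\<close>)
  have S2: "(\<lambda>q. s \<circ> q) ` C = {p \<in> A. p (Suc n) = n \<and> p n \<noteq> Suc n}" (is "_ = ?H")
  proof (intro set_eqI iffI)
    fix p assume "p \<in> ?H"
    then have "s \<circ> p \<in> C" "p = s \<circ> (s \<circ> p)"
      using closed s by (auto simp: inA C_def sx comp_assoc[symmetric])
    then show "p \<in> (\<lambda>q. s \<circ> q) ` C" by blast
  qed (use closed s in \<open>auto simp: inA C_def sx\<close>)
  have S3: "(\<lambda>q. s \<circ> q \<circ> s) ` C = {p \<in> A. p n = n \<and> p (Suc n) \<noteq> Suc n}" (is "_ = ?I")
  proof (intro set_eqI iffI)
    fix p assume "p \<in> ?I"
    then have "s \<circ> p \<circ> s \<in> C" "p = s \<circ> (s \<circ> p \<circ> s) \<circ> s"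
      using closed by (auto simp: s(1,2) inA C_def sx ss comp_assoc fun_eq_iff)
    then show "p \<in> (\<lambda>q. s \<circ> q \<circ> s) ` C" by blast
  qed (use closed in \<open>auto simp: s(1,2) inA C_def sx\<close>)
  \<comment> \<open>The extra inequalities keep \<open>?H\<close> off \<open>?G\<close> and
    \<open>?I\<close> off \<open>B\<close>; injectivity (\<open>inj_q\<close>) separates
    \<open>B\<close> from \<open>?G\<close> and \<open>?H\<close> from \<open>?I\<close>.\<close>
  have A_eq: "A = (B \<union> ?G) \<union> (?H \<union> ?I)"
    using almost_increasing_top_cases[OF _ n1] inA unfolding A_def by blast
  have "card A = card (B \<union> ?G) + card (?H \<union> ?I)"
    by (subst A_eq, rule card_Un_disjoint) (use fin in \<open>auto simp: inA\<close>)
  also have "card (B \<union> ?G) = card B + card ?G"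
    by (rule card_Un_disjoint) (use fin in \<open>auto simp: inA dest!: inj_q\<close>)
  also have "card (?H \<union> ?I) = card ?H + card ?I"
    by (rule card_Un_disjoint) (use fin in \<open>auto simp: inA dest!: inj_q\<close>)
  finally have "card A = card B + card ?G + (card ?H + card ?I)" .
  moreover have "card ?G = card B" "card ?H = card C" "card ?I = card C"
    by (simp_all flip: S1 S2 S3 add: card_image injs)
  ultimately have "card A = 2 * card B + 2 * card C" by simp
  moreover have "B = C \<union> almost_increasing_perms m" "C \<inter> almost_increasing_perms m = {}"
    using almost_increasing_perms_eq_fixing_top[of m] by (auto simp: B_def C_def n_def)
  then have "card B = card C + card (almost_increasing_perms m)"
    using fin by (metis card_Un_disjoint finite_Un)
  ultimately show ?thesis by (simp add: A_def B_def n_def)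
qed

lemma card_almost_increasing_perms_base:
  "card (almost_increasing_perms 0) = 1" "card (almost_increasing_perms (Suc 0)) = 1"
proof -
  have "perms 0 = {id}"
    by (simp add: perms_def)
  moreover have "perms (Suc 0) = {id}"
    by (simp add: perms_def)
  moreover have "one_almost_increasing 0 id"
    by (simp add: one_almost_increasing_def)
  moreover from this have "one_almost_increasing (Suc 0) id"
    using one_almost_increasing_extend[of id 0] permutes_id by blast
  ultimately have "almost_increasing_perms 0 = {id}" "almost_increasing_perms (Suc 0) = {id}"
    unfolding almost_increasing_perms_def by blast+
  then show "card (almost_increasing_perms 0) = 1" "card (almost_increasing_perms (Suc 0)) = 1"
    by simp_all
qed

section \<open>Words avoiding the evil patterns\<close>

text \<open>The disjuncts are the patterns 2413, 4132, 4213, 3214, in this order.\<close>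

definition evil :: "nat \<Rightarrow> nat \<Rightarrow> nat \<Rightarrow> nat \<Rightarrow> bool" where
  "evil a b c d \<longleftrightarrow>
     c < a \<and> a < d \<and> d < b \<or> b < d \<and> d < c \<and> c < a \<or>
     c < b \<and> b < d \<and> d < a \<or> c < b \<and> b < a \<and> a < d"

definition evil_free :: "nat list \<Rightarrow> bool" where
  "evil_free xs \<longleftrightarrow> (\<forall>a b c d. subseq [a, b, c, d] xs \<longrightarrow> \<not> evil a b c d)"

lemma evil_freeD: "evil_free xs \<Longrightarrow> subseq [a, b, c, d] xs \<Longrightarrow> \<not> evil a b c d"
  unfolding evil_free_def by blast

lemma evil_free_subseq: "evil_free ys \<Longrightarrow> subseq xs ys \<Longrightarrow> evil_free xs"
  unfolding evil_free_def by (meson subseq_order.trans)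

lemma subseq_map_conv: "subseq ys (map f xs) \<longleftrightarrow> (\<exists>zs. subseq zs xs \<and> ys = map f zs)"
  by (auto simp: subseq_conv_nths nths_map)

lemma subseq_set: "subseq xs ys \<Longrightarrow> set xs \<subseteq> set ys"
  by (auto simp: subseq_conv_nths dest: in_set_nthsD)

lemma evil_free_map:
  assumes "strict_mono_on (set xs) f"
  shows "evil_free (map f xs) \<longleftrightarrow> evil_free xs"
proof -
  have evil_f: "evil (f a) (f b) (f c) (f d) \<longleftrightarrow> evil a b c d" if "subseq [a, b, c, d] xs" for a b c d
  proof -
    have "a \<in> set xs" "b \<in> set xs" "c \<in> set xs" "d \<in> set xs"
      using subseq_set[OF that] by simp_all
    then show ?thesis
      unfolding evil_def by (simp only: strict_mono_on_less[OF assms])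
  qed
  show ?thesis
  proof
    assume ef: "evil_free (map f xs)"
    show "evil_free xs"
      unfolding evil_free_def
    proof (intro allI impI)
      fix a b c d assume sub: "subseq [a, b, c, d] xs"
      from subseq_map[OF this, of f] have "\<not> evil (f a) (f b) (f c) (f d)"
        using ef by (simp add: evil_free_def)
      then show "\<not> evil a b c d" using evil_f[OF sub] by simp
    qed
  next
    assume ef: "evil_free xs"
    show "evil_free (map f xs)"
      unfolding evil_free_def
    proof (intro allI impI)
      fix a b c d assume "subseq [a, b, c, d] (map f xs)"
      then obtain zs where zs: "subseq zs xs" "map f zs = [a, b, c, d]"
        unfolding subseq_map_conv by metis
      from zs(2) obtain a' b' c' d' where z: "zs = [a', b', c', d']"
        and f: "a = f a'" "b = f b'" "c = f c'" "d = f d'"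
        by (auto simp: map_eq_Cons_conv)
      have "\<not> evil a' b' c' d'" using ef zs(1) z by (simp add: evil_free_def)
      then show "\<not> evil a b c d" using evil_f[of a' b' c' d'] zs(1) z f by simp
    qed
  qed
qed

text \<open>The condition under which a new minimum may be inserted between \<open>P\<close> and \<open>Q\<close>: each
  conjunct is an evil pattern with its letter 1 sitting in the gap.\<close>

definition gap_open :: "nat list \<Rightarrow> nat list \<Rightarrow> bool" where
  "gap_open P Q \<longleftrightarrow>
     (\<forall>x y w. subseq [x, y] P \<longrightarrow> w \<in> set Q \<longrightarrow>
        \<not> (x < w \<and> w < y) \<and> \<not> (y < w \<and> w < x) \<and> \<not> (y < x \<and> x < w)) \<and>
     (\<forall>x y w. x \<in> set P \<longrightarrow> subseq [y, w] Q \<longrightarrow> \<not> (w < y \<and> y < x))"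

lemma gap_openI:
  assumes "\<And>x y w. subseq [x, y] P \<Longrightarrow> w \<in> set Q \<Longrightarrow>
      \<not> (x < w \<and> w < y) \<and> \<not> (y < w \<and> w < x) \<and> \<not> (y < x \<and> x < w)"
    and "\<And>x y w. x \<in> set P \<Longrightarrow> subseq [y, w] Q \<Longrightarrow> \<not> (w < y \<and> y < x)"
  shows "gap_open P Q"
  unfolding gap_open_def by (rule conjI; intro allI impI; rule assms; assumption)

lemma gap_openD:
  assumes "gap_open P Q"
  shows "subseq [x, y] P \<Longrightarrow> w \<in> set Q \<Longrightarrow>
      \<not> (x < w \<and> w < y) \<and> \<not> (y < w \<and> w < x) \<and> \<not> (y < x \<and> x < w)"
    and "x \<in> set P \<Longrightarrow> subseq [y, w] Q \<Longrightarrow> \<not> (w < y \<and> y < x)"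
  using assms unfolding gap_open_def by blast+

text \<open>No evil pattern has its letter 1 in first or last place. So an occurrence using the new
  minimum \<open>z\<close> has \<open>z\<close> in second place (4132) or in third place (2413,
  4213, 3214), and \<open>gap_open\<close> excludes precisely these.\<close>

lemma evil_free_insert_min:
  assumes min: "\<And>x. x \<in> set P \<union> set Q \<Longrightarrow> z < x"
  shows "evil_free (P @ z # Q) \<longleftrightarrow> evil_free (P @ Q) \<and> gap_open P Q"
proof
  assume ef: "evil_free (P @ z # Q)"
  have "subseq (P @ Q) (P @ z # Q)"
    by (intro list_emb_append_mono) auto
  with ef have "evil_free (P @ Q)" by (rule evil_free_subseq)
  moreover have "gap_open P Q"
  proof (rule gap_openI)
    fix x y w assume xy: "subseq [x, y] P" and w: "w \<in> set Q"
    have "subseq ([x, y] @ z # [w]) (P @ z # Q)"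
      using xy w by (intro list_emb_append_mono) (auto simp: subseq_singleton_left)
    then have "\<not> evil x y z w" using evil_freeD[OF ef] by simp
    moreover have "z < x" "z < y" "z < w" using min w subseq_set[OF xy] by auto
    ultimately show "\<not> (x < w \<and> w < y) \<and> \<not> (y < w \<and> w < x) \<and> \<not> (y < x \<and> x < w)"
      by (auto simp: evil_def)
  next
    fix x y w assume x: "x \<in> set P" and yw: "subseq [y, w] Q"
    have "subseq ([x] @ z # [y, w]) (P @ z # Q)"
      using x yw by (intro list_emb_append_mono) (auto simp: subseq_singleton_left)
    then have "\<not> evil x z y w" using evil_freeD[OF ef] by simp
    moreover have "z < x" "z < y" "z < w" using min x subseq_set[OF yw] by auto
    ultimately show "\<not> (w < y \<and> y < x)"
      by (auto simp: evil_def)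
  qed
  ultimately show "evil_free (P @ Q) \<and> gap_open P Q" ..
next
  assume "evil_free (P @ Q) \<and> gap_open P Q"
  then have ef: "evil_free (P @ Q)" and gap: "gap_open P Q" by auto
  show "evil_free (P @ z # Q)"
    unfolding evil_free_def
  proof (intro allI impI)
    fix a b c d assume "subseq [a, b, c, d] (P @ z # Q)"
    then obtain us vs where uv: "[a, b, c, d] = us @ vs" "subseq us P" "subseq vs (z # Q)"
      by (rule subseq_appendE)
    show "\<not> evil a b c d"
    proof (cases "subseq vs Q")
      case True
      then have "subseq [a, b, c, d] (P @ Q)"
        unfolding uv(1) using uv(2) by (intro list_emb_append_mono)
      then show ?thesis by (rule evil_freeD[OF ef])
    next
      case False
      with uv(3) obtain vs' where vs: "vs = z # vs'" "subseq vs' Q"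
        by (cases vs) (auto split: if_splits)
      have less: "z < x" if "x \<in> set us \<union> set vs'" for x
        using that min subseq_set[OF uv(2)] subseq_set[OF vs(2)] by auto
      \<comment> \<open>The cases are the four places that \<open>z\<close> can take in the
        occurrence.\<close>
      from uv(1) vs(1) consider
          "a = z" "vs' = [b, c, d]"
        | "us = [a]" "b = z" "vs' = [c, d]"
        | "us = [a, b]" "c = z" "vs' = [d]"
        | "us = [a, b, c]" "d = z"
        by (auto simp: Cons_eq_append_conv)
      then show ?thesis
      proof cases
        case 1
        then have "z < b" "z < c" "z < d" using less by simp_all
        then show ?thesis by (simp add: 1(1) evil_def not_less)
      next
        case 2
        then have "\<not> (d < c \<and> c < a)"
          using gap_openD(2)[OF gap, of a c d] uv(2) vs(2) by (simp add: subseq_singleton_left)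
        moreover have "z < a" "z < c" "z < d" using 2 less by simp_all
        ultimately show ?thesis by (simp add: 2(2) evil_def not_less)
      next
        case 3
        then have "\<not> (a < d \<and> d < b) \<and> \<not> (b < d \<and> d < a) \<and> \<not> (b < a \<and> a < d)"
          using gap_openD(1)[OF gap, of a b d] uv(2) vs(2) by (simp add: subseq_singleton_left)
        moreover have "z < a" "z < b" "z < d" using 3 less by simp_all
        ultimately show ?thesis by (simp add: 3(2) evil_def not_less)
      next
        case 4
        then have "z < a" "z < b" "z < c" using less by simp_all
        then show ?thesis by (simp add: 4(2) evil_def not_less)
      qed
    qed
  qed
qed

section \<open>Consequences of an open gap\<close>

lemma gap_open_Nil [simp]: "gap_open [] Q" "gap_open P []"
  by (auto simp: gap_open_def)

lemma subseq_pair_distinct: "subseq [u, v] xs \<Longrightarrow> distinct xs \<Longrightarrow> u \<noteq> v"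
  by (induction xs) (auto simp: subseq_singleton_left split: if_splits)

text \<open>If \<open>x < a\<close> comes after \<open>a\<close> in the left block, a letter of
  \<open>Q\<close> cannot lie between them (4213) or above \<open>a\<close> (3214), so it lies below
  \<open>x\<close>. Thus \<open>Q\<close> lies below \<open>y\<close>, hence below every left
  letter, and a descent in \<open>Q\<close> would complete a 4132 with \<open>a\<close>.\<close>

lemma gap_open_descent:
  assumes gap: "gap_open (a # P) Q" and y: "y \<in> set P" "y < a" and dist: "distinct (a # P @ Q)"
  shows "\<And>x w. x \<in> set (a # P) \<Longrightarrow> w \<in> set Q \<Longrightarrow> w < x"
    and "\<And>u v. subseq [u, v] Q \<Longrightarrow> u < v"
proof -
  have below: "w < x" if "x \<in> set P" "x < a" "w \<in> set Q" for x w
  proof -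
    have "subseq [a, x] (a # P)" using that by (simp add: subseq_singleton_left)
    then have "\<not> (x < w \<and> w < a) \<and> \<not> (x < a \<and> a < w)"
      using gap_openD(1)[OF gap _ that(3), of a x] by blast
    moreover have "w \<noteq> x" "w \<noteq> a" using that dist by auto
    ultimately show ?thesis using that by linarith
  qed
  show lt: "w < x" if "x \<in> set (a # P)" "w \<in> set Q" for x w
  proof (cases "x < a")
    case True
    then show ?thesis using below that by auto
  next
    case False
    then show ?thesis using below[OF y that(2)] y(2) by linarith
  qed
  show "u < v" if uv: "subseq [u, v] Q" for u v
  proof -
    have "u < a" using lt subseq_set[OF uv] by auto
    moreover have "\<not> (v < u \<and> u < a)"
      using gap_openD(2)[OF gap _ uv, of a] by simp
    ultimately show ?thesis
      using subseq_pair_distinct[OF uv] dist by auto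
  qed
qed

text \<open>Converse to \<open>gap_open_descent\<close>: 2413, 4213 and 3214 each need a letter of
  \<open>Q\<close> above one of \<open>P\<close>, and 4132 needs a descent in
  \<open>Q\<close>.\<close>

lemma gap_open_if_below:
  assumes "\<And>x w. x \<in> set P \<Longrightarrow> w \<in> set Q \<Longrightarrow> w < x"
    and "\<And>u v. subseq [u, v] Q \<Longrightarrow> u < v"
  shows "gap_open P Q"
proof (rule gap_openI)
  fix x y w assume "subseq [x, y] P" "w \<in> set Q"
  then have "w < x" "w < y" using assms(1) subseq_set[of "[x, y]" P] by auto
  then show "\<not> (x < w \<and> w < y) \<and> \<not> (y < w \<and> w < x) \<and> \<not> (y < x \<and> x < w)" by auto
next
  fix x y w assume "subseq [y, w] Q"
  then show "\<not> (w < y \<and> y < x)" using assms(2)[of y w] by auto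
qed

text \<open>Serves to undo the deletion of the first letter. A new occurrence starts with
  \<open>a\<close>; the proof distinguishes how many of its other three letters lie in
  \<open>P\<close>.\<close>

lemma evil_free_Cons_below_min:
  assumes ef: "evil_free (P @ z # Q)" and dist: "distinct (P @ z # Q)"
    and z: "\<And>x. x \<in> set P \<union> set Q \<Longrightarrow> z < x" "z < a"
    and b: "b \<in> set P" "\<And>x. x \<in> set P \<Longrightarrow> b \<le> x" "a < b"
    and between: "\<And>x. x \<in> set Q \<Longrightarrow> a < x \<Longrightarrow> b \<le> x"
  shows "evil_free (a # P @ z # Q)"
proof -
  have gap: "gap_open P Q" using ef z(1) evil_free_insert_min by blast
  have none: "\<not> evil a x y w" if xyw: "subseq [x, y, w] (P @ z # Q)" for x y w
  proof
    assume evil: "evil a x y w"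
    \<comment> \<open>No letter in \<open>P\<close>: a letter of \<open>z # Q\<close> above
      \<open>a\<close> is above \<open>b\<close>, and one below \<open>a\<close> is below
      \<open>b\<close>. So \<open>b\<close> can replace \<open>a\<close>, and the occurrence was
      there before.\<close>
    have evil_b: False if "subseq [x, y, w] (z # Q)"
    proof -
      have "subseq ([b] @ [x, y, w]) (P @ z # Q)"
        using that b(1) by (intro list_emb_append_mono) (auto simp: subseq_singleton_left)
      then have "\<not> evil b x y w" using evil_freeD[OF ef] by simp
      moreover have "b < v" if "v \<in> {x, y, w}" "a < v" for v
      proof -
        have "v \<in> set (z # Q)" using subseq_set[OF \<open>subseq [x, y, w] (z # Q)\<close>] that by auto
        then have "v \<in> set Q" "v \<noteq> b" using that z(2) dist b(1) by auto
        then show ?thesis using between that(2) by fastforce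
      qed
      ultimately show False using evil b(3) unfolding evil_def
        by (metis insert_iff less_trans)
    qed
    obtain us vs where uv: "[x, y, w] = us @ vs" "subseq us P" "subseq vs (z # Q)"
      using xyw by (rule subseq_appendE)
    then consider "us = []" "vs = [x, y, w]" | "us = [x]" "vs = [y, w]" | us' where "us = x # y # us'"
      by (auto simp: Cons_eq_append_conv)
    then show False
    proof cases
      case 1
      then show False using evil_b uv by simp
    next
      \<comment> \<open>One letter \<open>x\<close> in \<open>P\<close>: since \<open>a < x\<close>,
        only 2413 is possible, so \<open>b < w < x\<close> with \<open>w\<close> in
        \<open>Q\<close>. The letters \<open>b\<close> and \<open>x\<close>, in either order, then
        contradict \<open>gap\<close> (2413 or 4213).\<close>
      case 2
      then have x: "x \<in> set P" using uv by (simp add: subseq_singleton_left)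
      then have "a < x" using b by fastforce
      then have ev: "y < a" "a < w" "w < x" using evil by (auto simp: evil_def)
      have "w \<in> set Q" using subseq_set[OF uv(3)] 2 ev z(2) by auto
      moreover from this have "b < w"
        using between[of w] ev(2) b(1) dist by (metis Un_iff disjoint_iff distinct_append le_neq_implies_less list.set_intros(2))
      moreover have "subseq [x, b] P \<or> subseq [b, x] P"
      proof -
        have "x \<noteq> b" using ev \<open>b < w\<close> by auto
        obtain P1 P2 where P: "P = P1 @ x # P2" using x by (meson split_list)
        then have "b \<in> set P1 \<or> b \<in> set P2" using b(1) \<open>x \<noteq> b\<close> by auto
        then show ?thesis
        proof
          assume "b \<in> set P1"
          then have "subseq ([b] @ [x]) (P1 @ x # P2)"
            by (intro list_emb_append_mono) (auto simp: subseq_singleton_left)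
          then show ?thesis using P by simp
        next
          assume "b \<in> set P2"
          then have "subseq ([] @ [x, b]) (P1 @ x # P2)"
            by (intro list_emb_append_mono) (auto simp: subseq_singleton_left)
          then show ?thesis using P by simp
        qed
      qed
      ultimately show False using gap_openD(1)[OF gap, of x b w] gap_openD(1)[OF gap, of b x w] ev(3) by blast
    next
      \<comment> \<open>Two or more letters in \<open>P\<close>: no evil pattern has its second and
        third letters both above its first.\<close>
      case 3
      then have "a < x" "a < y" using subseq_set[OF uv(2)] b(2,3) by fastforce+
      then show False using evil by (auto simp: evil_def)
    qed
  qed
  show ?thesis
    unfolding evil_free_def
  proof (intro allI impI)
    fix x y w v assume "subseq [x, y, w, v] (a # P @ z # Q)"
    then show "\<not> evil x y w v"
      using none[of y w v] evil_freeD[OF ef, of x y w v] by (simp split: if_splits)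
  qed
qed

section \<open>Counting evil-free words\<close>

text \<open>The alphabet is a parameter because deleting \<open>0\<close> leaves a word over
  \<open>{1..n}\<close>, which is only afterwards renumbered.\<close>

definition evil_free_words :: "nat set \<Rightarrow> nat list set" where
  "evil_free_words S = {xs. distinct xs \<and> set xs = S \<and> evil_free xs}"

lemma finite_evil_free_words: "finite S \<Longrightarrow> finite (evil_free_words S)"
  unfolding evil_free_words_def
  by (rule finite_subset[OF _ finite_subset_distinct[of S]]) auto

lemma card_evil_free_words_image:
  assumes "strict_mono_on S f"
  shows "card (evil_free_words (f ` S)) = card (evil_free_words S)"
proof -
  have inj: "inj_on f S"
    using assms by (rule strict_mono_on_imp_inj_on)
  have "evil_free_words (f ` S) = map f ` evil_free_words S"
  proof (intro set_eqI iffI)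
    fix ys assume ys: "ys \<in> evil_free_words (f ` S)"
    then have "set ys = f ` S" by (simp add: evil_free_words_def)
    then have "ys \<in> map f ` lists S"
      by (metis in_lists_conv_set lists_image subsetI subset_refl)
    then obtain xs where xs: "ys = map f xs" "set xs \<subseteq> S" by auto
    then have "set xs = S"
      using \<open>set ys = f ` S\<close> inj by (auto simp: inj_on_image_eq_iff)
    then have "xs \<in> evil_free_words S"
      using ys xs(1) assms by (simp add: evil_free_words_def distinct_map evil_free_map)
    then show "ys \<in> map f ` evil_free_words S" using xs(1) by blast
  next
    fix ys assume "ys \<in> map f ` evil_free_words S"
    then show "ys \<in> evil_free_words (f ` S)"
      using assms inj by (auto simp: evil_free_words_def distinct_map evil_free_map)
  qed
  moreover have "inj_on (map f) (evil_free_words S)"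
    by (intro inj_on_mapI inj_on_subset[OF inj]) (auto simp: evil_free_words_def)
  ultimately show ?thesis by (simp add: card_image)
qed

lemma card_evil_free_words_Suc: "card (evil_free_words {1..n}) = card (evil_free_words {..<n})"
  using card_evil_free_words_image[of "{..<n}" Suc]
  by (simp add: strict_mono_onI image_Suc_lessThan)

section \<open>Classification by the position of the letter 0\<close>

definition interior_words :: "nat \<Rightarrow> nat list set" where
  "interior_words n =
     {xs \<in> evil_free_words {..<n}. \<exists>P Q. xs = P @ 0 # Q \<and> P \<noteq> [] \<and> Q \<noteq> []}"

lemma evil_free_words_insert_0:
  "P @ 0 # Q \<in> evil_free_words {..<Suc n} \<longleftrightarrow> P @ Q \<in> evil_free_words {1..n} \<and> gap_open P Q"
proof (cases "distinct (P @ Q) \<and> set (P @ Q) = {1..n}")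
  case True
  then have "x > 0" if "x \<in> set P \<union> set Q" for x using that by (auto simp: Suc_le_eq)
  then have "evil_free (P @ 0 # Q) \<longleftrightarrow> evil_free (P @ Q) \<and> gap_open P Q"
    by (rule evil_free_insert_min)
  moreover have "0 \<notin> set (P @ Q)" using True by auto
  moreover have "{..<Suc n} = insert 0 {1..n}" by auto
  moreover have "set (P @ 0 # Q) = insert 0 (set (P @ Q))" by simp
  moreover have "distinct (P @ 0 # Q) \<longleftrightarrow> distinct (P @ Q) \<and> 0 \<notin> set (P @ Q)" by auto
  ultimately show ?thesis
    unfolding evil_free_words_def using True by blast
next
  case False
  moreover have False if "distinct (P @ 0 # Q)" "set (P @ 0 # Q) = {..<Suc n}"
  proof -
    have "set (P @ Q) = set (P @ 0 # Q) - {0}" using that(1) by auto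
    also have "\<dots> = {1..n}" unfolding that(2) by auto
    finally show False using False that(1) by auto
  qed
  ultimately show ?thesis unfolding evil_free_words_def by blast
qed

text \<open>A gap with an empty side is always open, so \<open>0\<close> may be put first or last.
  For \<open>n = 0\<close> these two words would coincide.\<close>

lemma card_evil_free_words_split:
  assumes "n \<ge> 1"
  shows "card (evil_free_words {..<Suc n}) = 2 * card (evil_free_words {..<n}) + card (interior_words (Suc n))"
proof -
  let ?W = "evil_free_words {..<Suc n}" and ?V = "evil_free_words {1..n}"
  have nonempty: "q \<noteq> []" if "q \<in> ?V" for q
    using that assms by (auto simp: evil_free_words_def)
  have zero: "0 \<notin> set q" if "q \<in> ?V" for q
    using that by (auto simp: evil_free_words_def)
  have "?W = ((#) 0 ` ?V \<union> (\<lambda>q. q @ [0]) ` ?V) \<union> interior_words (Suc n)"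
  proof (intro set_eqI iffI)
    fix xs assume xs: "xs \<in> ?W"
    then have "0 \<in> set xs" by (simp add: evil_free_words_def)
    then obtain P Q where PQ: "xs = P @ 0 # Q" by (meson split_list)
    then have "P @ Q \<in> ?V" using xs evil_free_words_insert_0 by blast
    then show "xs \<in> ((#) 0 ` ?V \<union> (\<lambda>q. q @ [0]) ` ?V) \<union> interior_words (Suc n)"
      using xs PQ by (cases "P = []"; cases "Q = []") (auto simp: interior_words_def)
  next
    fix xs assume "xs \<in> ((#) 0 ` ?V \<union> (\<lambda>q. q @ [0]) ` ?V) \<union> interior_words (Suc n)"
    then show "xs \<in> ?W"
      using evil_free_words_insert_0[of "[]" _ n] evil_free_words_insert_0[of _ "[]" n]
      by (auto simp: interior_words_def)
  qed
  moreover have "((#) 0 ` ?V \<union> (\<lambda>q. q @ [0]) ` ?V) \<inter> interior_words (Suc n) = {}"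
  proof -
    have "P = [] \<or> Q = []" if "q \<in> ?V" "0 # q = P @ 0 # Q \<or> q @ [0] = P @ 0 # Q" for q P Q
      using that(2)
    proof
      assume "0 # q = P @ 0 # Q"
      then show ?thesis using zero[OF that(1)] by (auto simp: Cons_eq_append_conv)
    next
      assume "q @ [0] = P @ 0 # Q"
      then show ?thesis using zero[OF that(1)]
        by (cases Q rule: rev_cases) auto
    qed
    then show ?thesis unfolding interior_words_def by blast
  qed
  moreover have "(#) 0 ` ?V \<inter> (\<lambda>q. q @ [0]) ` ?V = {}"
  proof -
    have "0 # q \<noteq> r @ [0]" if "q \<in> ?V" "r \<in> ?V" for q r
      using zero[OF that(2)] nonempty[OF that(2)] by (auto simp: Cons_eq_append_conv)
    then show ?thesis by blast
  qed
  moreover have "finite ?V" "finite (interior_words (Suc n))"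
    unfolding interior_words_def by (simp_all add: finite_evil_free_words)
  moreover have "card ((#) 0 ` ?V) = card ?V" "card ((\<lambda>q. q @ [0]) ` ?V) = card ?V"
    by (auto intro!: card_image inj_onI)
  ultimately show ?thesis
    using card_evil_free_words_Suc[of n] by (simp add: card_Un_disjoint)
qed

text \<open>The case in which the first letter will be deleted; the block before \<open>0\<close> is
  \<open>a # P\<close>.\<close>

definition rising_words :: "nat \<Rightarrow> nat list set" where
  "rising_words n =
     {xs \<in> evil_free_words {..<n}. \<exists>a P Q. xs = a # P @ 0 # Q \<and> P \<noteq> [] \<and> Q \<noteq> [] \<and> (\<forall>x\<in>set P. a < x)}"

text \<open>The case in which \<open>0\<close> will be deleted.\<close>

definition falling_words :: "nat \<Rightarrow> nat list set" where
  "falling_words n =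
     {xs \<in> evil_free_words {..<n}. \<exists>a P Q. xs = a # P @ 0 # Q \<and> Q \<noteq> [] \<and> (P = [] \<or> (\<exists>x\<in>set P. x < a))}"

lemma card_interior_words_split:
  "card (interior_words n) = card (rising_words n) + card (falling_words n)"
proof -
  have "interior_words n = rising_words n \<union> falling_words n"
  proof (intro set_eqI iffI)
    fix xs assume xs: "xs \<in> interior_words n"
    then obtain a P Q where PQ: "xs = a # P @ 0 # Q" "Q \<noteq> []"
      unfolding interior_words_def by (auto simp: neq_Nil_conv)
    have W: "xs \<in> evil_free_words {..<n}" using xs by (simp add: interior_words_def)
    then have "distinct xs" by (simp add: evil_free_words_def)
    then have "a \<notin> set P" using PQ(1) by simp
    then consider "P \<noteq> []" "\<forall>x\<in>set P. a < x" | "P = [] \<or> (\<exists>x\<in>set P. x < a)"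
      by (metis linorder_neqE_nat)
    then show "xs \<in> rising_words n \<union> falling_words n"
      using W PQ unfolding rising_words_def falling_words_def by cases blast+
  next
    fix xs assume "xs \<in> rising_words n \<union> falling_words n"
    then show "xs \<in> interior_words n"
      unfolding interior_words_def rising_words_def falling_words_def
      by (smt (verit) Un_iff append_Cons list.distinct(1) mem_Collect_eq)
  qed
  moreover have "rising_words n \<inter> falling_words n = {}"
  proof -
    have False if *: "distinct (a # P @ 0 # Q)" "a # P @ 0 # Q = a' # P' @ 0 # Q'" "P \<noteq> []"
      "\<forall>x\<in>set P. a < x" "P' = [] \<or> (\<exists>x\<in>set P'. x < a')" for a a' :: nat and P P' Q Q'
    proof -
      have "0 \<notin> set P" "0 \<notin> set Q" using *(1) by simp_all
      moreover have "a = a'" "P @ 0 # Q = P' @ 0 # Q'" using *(2) by simp_all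
      ultimately have "a = a'" "P = P'" by (simp_all add: append_Cons_eq_iff)
      then obtain x where "x \<in> set P" "x < a" using *(3,5) by blast
      then show False using *(4) by (meson order_less_asym)
    qed
    then show ?thesis unfolding rising_words_def falling_words_def evil_free_words_def by blast
  qed
  moreover have "finite (rising_words n)" "finite (falling_words n)"
    unfolding rising_words_def falling_words_def by (simp_all add: finite_evil_free_words)
  ultimately show ?thesis by (simp add: card_Un_disjoint)
qed

section \<open>Falling words: deleting the letter 0\<close>

lemma inj_on_remove_0_falling_words: "inj_on (remove1 0) (falling_words n)"
proof -
  \<comment> \<open>Two falling words with the same image would have \<open>0\<close> before and
    after some nonempty block \<open>U\<close>. \<open>PU\<close> is the falling condition of the
    word with the later \<open>0\<close>, whose \<open>P @ U\<close> is nonempty.\<close>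
  have no_shift: False
    if ef: "evil_free (a # P @ 0 # U @ Q)" "evil_free (a # P @ U @ 0 # Q)"
      and dist: "distinct (a # P @ 0 # U @ Q)" and ne: "U \<noteq> []" "Q \<noteq> []"
      and P: "P = [] \<or> (\<exists>x\<in>set P. x < a)" and PU: "\<exists>x\<in>set (P @ U). x < a"
    for a :: nat and P U Q
  proof -
    have pos: "0 < x" if "x \<in> set (a # P @ U @ Q)" for x
      using dist that by (metis Un_iff bot_nat_0.not_eq_extremum distinct.simps(2)
          distinct_append disjoint_iff list.set_intros(1) set_append set_ConsD)
    have gap1: "gap_open (a # P) (U @ Q)"
      using ef(1) evil_free_insert_min[of "a # P" "U @ Q" 0] pos by auto
    have gap2: "gap_open (a # P @ U) Q"
      using ef(2) evil_free_insert_min[of "a # P @ U" Q 0] pos by auto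
    obtain w where w: "w \<in> set Q" using ne(2) by (meson last_in_set)
    \<comment> \<open>By \<open>gap_open_descent\<close> at the later gap, \<open>w\<close> lies
      below all of \<open>U\<close>; each case below contradicts this at the earlier gap.\<close>
    have below: "w < x" if "x \<in> set (P @ U)" for x
      using gap_open_descent(1)[OF gap2 _ _ _ _ w] PU dist that by auto
    have pair: "subseq [u, w] (U @ Q)" if "u \<in> set U" for u
      using that w list_emb_append_mono[of "(=)" "[u]" U "[w]" Q]
      by (simp add: subseq_singleton_left)
    show False
    proof (cases "P = []")
      case True
      then obtain y where "y \<in> set U" "y < a" using PU by auto
      then show False
        using gap_openD(2)[OF gap1 _ pair, of a y] below[of y] by auto
    next
      case False
      then obtain y where y: "y \<in> set P" "y < a" using P by auto
      have "hd U < w"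
        using gap_open_descent(2)[OF gap1 y _ pair] dist ne(1) by simp
      then show False using below[of "hd U"] ne(1) by simp
    qed
  qed
  show ?thesis
  proof (rule inj_onI)
    fix xs xs' assume xs: "xs \<in> falling_words n" "xs' \<in> falling_words n"
      and eq: "remove1 0 xs = remove1 0 xs'"
    obtain a P Q where P: "xs = a # P @ 0 # Q" "Q \<noteq> []" "P = [] \<or> (\<exists>x\<in>set P. x < a)"
      and W: "distinct xs" "evil_free xs"
      using xs(1) unfolding falling_words_def evil_free_words_def by blast
    obtain a' P' Q' where P': "xs' = a' # P' @ 0 # Q'" "Q' \<noteq> []" "P' = [] \<or> (\<exists>x\<in>set P'. x < a')"
      and W': "distinct xs'" "evil_free xs'"
      using xs(2) unfolding falling_words_def evil_free_words_def by blast
    have "remove1 0 xs = a # P @ Q" "remove1 0 xs' = a' # P' @ Q'"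
      using W(1) W'(1) unfolding P(1) P'(1) by (auto simp: remove1_append)
    then have a: "a = a'" and "P @ Q = P' @ Q'" using eq by auto
    then obtain U where "P = P' @ U \<and> U @ Q = Q' \<or> P @ U = P' \<and> Q = U @ Q'"
      by (auto simp: append_eq_append_conv2)
    then show "xs = xs'"
    proof
      assume U: "P = P' @ U \<and> U @ Q = Q'"
      show ?thesis
      proof (cases "U = []")
        case False
        have False
          by (rule no_shift[of a P' U Q]) (use U False P P' W W' a in auto)
        then show ?thesis ..
      qed (use U P P' a in auto)
    next
      assume U: "P @ U = P' \<and> Q = U @ Q'"
      show ?thesis
      proof (cases "U = []")
        case False
        have False
          by (rule no_shift[of a P U Q']) (use U False P P' W W' a in auto)
        then show ?thesis ..
      qed (use U P P' a in auto)
    qed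
  qed
qed

text \<open>For a word \<open>a t\<close>, the letter \<open>0\<close> goes directly after \<open>a\<close> if the letters of \<open>t\<close> below \<open>a\<close> increase,
  and directly before the minimum otherwise.\<close>

lemma remove_0_falling_words:
  assumes "n \<ge> 2"
  shows "remove1 0 ` falling_words (Suc n) = evil_free_words {1..n}"
proof (intro set_eqI iffI)
  fix q assume "q \<in> remove1 0 ` falling_words (Suc n)"
  then obtain a P Q where W: "a # P @ 0 # Q \<in> evil_free_words {..<Suc n}"
    and q: "q = remove1 0 (a # P @ 0 # Q)"
    unfolding falling_words_def by blast
  have "distinct (a # P @ 0 # Q)" using W by (simp only: evil_free_words_def mem_Collect_eq)
  then have "q = (a # P) @ Q" using q by (auto simp: remove1_append)
  then show "q \<in> evil_free_words {1..n}"
    using W evil_free_words_insert_0[of "a # P" Q n] by simp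
next
  fix q assume q: "q \<in> evil_free_words {1..n}"
  then have dist: "distinct q" and set: "set q = {1..n}" and ef: "evil_free q"
    by (simp_all add: evil_free_words_def)
  have "length q = n" using distinct_card[OF dist] set by simp
  \<comment> \<open>With \<open>n \<ge> 2\<close> the word \<open>t\<close> is nonempty, so a
    \<open>0\<close> put directly after \<open>a\<close> is not the last letter.\<close>
  then obtain a t where at: "q = a # t" "t \<noteq> []"
    using assms by (cases q) force+
  have pos: "0 \<notin> set q" using set by simp
  show "q \<in> remove1 0 ` falling_words (Suc n)"
  proof (cases "\<exists>y w. subseq [y, w] t \<and> w < y \<and> y < a")
    case False
    have "gap_open [a] t"
      by (rule gap_openI) (use False in \<open>auto split: if_splits\<close>)
    then have "[a] @ 0 # t \<in> evil_free_words {..<Suc n}"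
      using q at(1) evil_free_words_insert_0[of "[a]" t n] by simp
    then have "a # 0 # t \<in> falling_words (Suc n)"
      unfolding falling_words_def using at(2) by force
    moreover have "remove1 0 (a # 0 # t) = q" using pos at(1) by auto
    ultimately show ?thesis by (metis imageI)
  next
    case True
    then obtain y w where yw: "subseq [y, w] t" "w < y" "y < a" by blast
    define m where "m = Min (set q)"
    have m: "m \<in> set q" "\<And>x. x \<in> set q \<Longrightarrow> m \<le> x"
      unfolding m_def using at(1) by (metis Min_in List.finite_set list.discI set_empty) (rule Min_le, simp_all)
    have "w \<in> set t" "y \<in> set t" using subseq_set[OF yw(1)] by auto
    then have "m \<noteq> a" "m \<noteq> y" using m(2)[of w] yw at(1) by auto
    then have "m \<in> set t" using m(1) at(1) by auto
    then obtain R T where RT: "t = R @ m # T" by (meson split_list)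
    have m_less: "m < x" if "x \<in> set (a # R) \<union> set T" for x
    proof -
      have "x \<noteq> m" using that dist at(1) RT by auto
      moreover have "m \<le> x" using that m(2) at(1) RT by auto
      ultimately show ?thesis by simp
    qed
    \<comment> \<open>The word is evil-free and \<open>m\<close> is its minimum, so the place
      occupied by \<open>m\<close> is itself an open gap.\<close>
    have gap: "gap_open (a # R) T"
      using ef at(1) RT evil_free_insert_min[of "a # R" T m] m_less by simp
    \<comment> \<open>Otherwise \<open>y\<close>, being below \<open>a\<close> and different from
      \<open>m\<close>, lies in \<open>T\<close> together with \<open>w\<close>, and
      \<open>a\<close>, \<open>m\<close>, \<open>y\<close>, \<open>w\<close> form a 4132.\<close>
    have "\<exists>y'\<in>set R. y' < a"
    proof (rule ccontr)
      assume neg: "\<not> (\<exists>y'\<in>set R. y' < a)"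
      obtain us vs where uv: "[y, w] = us @ vs" "subseq us R" "subseq vs (m # T)"
        using yw(1) unfolding RT by (rule subseq_appendE)
      have "us = []"
      proof (rule ccontr)
        assume "us \<noteq> []"
        then have "y \<in> set us" using uv(1) by (cases us) auto
        then show False using subseq_set[OF uv(2)] neg yw(3) by auto
      qed
      then have "subseq [y, w] T" using uv \<open>m \<noteq> y\<close> by auto
      then show False using gap_openD(2)[OF gap, of a y w] yw by simp
    qed
    then obtain y' where y': "y' \<in> set R" "y' < a" by blast
    have dist': "distinct (a # R @ T)" using dist at(1) RT by auto
    \<comment> \<open>By \<open>gap_open_descent\<close>, \<open>T\<close> is increasing and below
      \<open>a # R\<close>; putting the minimum \<open>m\<close> in front preserves both, so
      \<open>0\<close> fits directly before \<open>m\<close>.\<close>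
    have "gap_open (a # R) (m # T)"
    proof (rule gap_open_if_below)
      show "v < x" if "x \<in> set (a # R)" "v \<in> set (m # T)" for x v
        using that m_less[of x] gap_open_descent(1)[OF gap y' dist', of x v] by auto
      show "u < v" if "subseq [u, v] (m # T)" for u v
      proof (cases "u = m")
        case True
        then have "v \<in> set T" using that by (simp add: subseq_singleton_left)
        then show ?thesis using True m_less by simp
      next
        case False
        then show ?thesis using that gap_open_descent(2)[OF gap y' dist', of u v] by simp
      qed
    qed
    then have "(a # R) @ 0 # m # T \<in> evil_free_words {..<Suc n}"
      using q at(1) RT evil_free_words_insert_0[of "a # R" "m # T" n] by simp
    then have "a # R @ 0 # m # T \<in> falling_words (Suc n)"
      unfolding falling_words_def using y' by force
    moreover have "remove1 0 (a # R @ 0 # m # T) = q"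
      using pos at(1) RT by (auto simp: remove1_append)
    ultimately show ?thesis by (metis imageI)
  qed
qed

lemma card_falling_words:
  assumes "n \<ge> 2"
  shows "card (falling_words (Suc n)) = card (evil_free_words {..<n})"
  using card_image[OF inj_on_remove_0_falling_words, of "Suc n"] remove_0_falling_words[OF assms]
    card_evil_free_words_Suc[of n] by simp

section \<open>Rising words: deleting the first letter\<close>

text \<open>The inverse of deleting the first letter of a rising word and renumbering.\<close>

definition prepend_below :: "nat list \<Rightarrow> nat list" where
  "prepend_below xs =
     (let b = Min (set (takeWhile (\<lambda>x. x \<noteq> 0) xs)) in b # map (\<lambda>x. if x < b then x else Suc x) xs)"

lemma takeWhile_nonzero: "0 \<notin> set P \<Longrightarrow> takeWhile (\<lambda>x. x \<noteq> (0::nat)) (P @ 0 # Q) = P"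
  by (induction P) auto

text \<open>The head of the result reveals \<open>b\<close>, and with it the injective renumbering
  that was applied.\<close>

lemma inj_prepend_below: "inj prepend_below"
proof (rule injI)
  fix xs ys assume eq: "prepend_below xs = prepend_below ys"
  define b where "b = Min (set (takeWhile (\<lambda>x. x \<noteq> 0) xs))"
  define c where "c = Min (set (takeWhile (\<lambda>x. x \<noteq> 0) ys))"
  have bc: "b = c \<and> map (\<lambda>x. if x < b then x else Suc x) xs = map (\<lambda>x. if x < c then x else Suc x) ys"
    using eq unfolding prepend_below_def Let_def b_def c_def by (rule list.inject[THEN iffD1])
  have "map (\<lambda>x. if x < b then x else Suc x) xs = map (\<lambda>x. if x < b then x else Suc x) ys"
    using conjunct2[OF bc] unfolding conjunct1[OF bc] .
  moreover have "inj (\<lambda>x. if x < b then x else Suc x)"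
    by (rule injI) (auto split: if_splits)
  ultimately show "xs = ys"
    using inj_map_eq_map by blast
qed

text \<open>The renumbering skips exactly the value \<open>b\<close> and turns the minimum of the
  block before \<open>0\<close> into \<open>Suc b\<close>. No number lies strictly between
  \<open>b\<close> and \<open>Suc b\<close>, so \<open>evil_free_Cons_below_min\<close>
  applies.\<close>

lemma prepend_below_interior_words:
  assumes "xs \<in> interior_words n"
  shows "prepend_below xs \<in> rising_words (Suc n)"
proof -
  from assms obtain P Q where PQ: "xs = P @ 0 # Q" "P \<noteq> []" "Q \<noteq> []"
    and dist: "distinct xs" and set: "set xs = {..<n}" and ef: "evil_free xs"
    unfolding interior_words_def evil_free_words_def by blast
  define b where "b = Min (set P)"
  define f where "f = (\<lambda>x. if x < b then x else Suc x)"
  have nz: "0 \<notin> set P" "0 \<notin> set Q" using dist PQ(1) by auto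
  have "takeWhile (\<lambda>x. x \<noteq> 0) xs = P"
    unfolding PQ(1) using nz(1) by (rule takeWhile_nonzero)
  then have eq: "prepend_below xs = b # map f xs"
    by (simp add: prepend_below_def Let_def b_def f_def)
  have b: "b \<in> set P" "\<And>x. x \<in> set P \<Longrightarrow> b \<le> x"
    using PQ(2) by (simp_all add: b_def)
  have b_bounds: "0 < b" "b < n"
  proof -
    show "0 < b" using b(1) nz(1) by (metis gr0I)
    show "b < n" using b(1) set PQ(1) by auto
  qed
  have f0: "f 0 = 0" using b_bounds by (simp add: f_def)
  have mono: "strict_mono_on A f" for A
    by (rule strict_mono_onI) (auto simp: f_def)
  have "inj f" by (rule injI) (auto simp: f_def split: if_splits)
  then have dist_f: "distinct (map f xs)"
    using dist by (simp add: distinct_map inj_on_def inj_def)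
  have ef_f: "evil_free (map f xs)"
    using ef evil_free_map[OF mono] by simp
  have not_b: "f x \<noteq> b" for x by (simp add: f_def)
  have set_f: "insert b (f ` {..<n}) = {..<Suc n}"
  proof (intro set_eqI iffI)
    fix x assume "x \<in> {..<Suc n}"
    then have "x = b \<or> x < b \<and> f x = x \<or> x > b \<and> f (x - 1) = x"
      by (auto simp: f_def)
    then show "x \<in> insert b (f ` {..<n})"
    proof (elim disjE conjE)
      assume "x < b" "f x = x"
      then show ?thesis using b_bounds by (metis imageI insertCI lessThan_iff less_trans)
    next
      assume "b < x" "f (x - 1) = x"
      moreover have "x - 1 \<in> {..<n}" using \<open>x \<in> {..<Suc n}\<close> \<open>b < x\<close> by auto
      ultimately show ?thesis by (metis imageI insertCI)
    qed simp
  qed (use b_bounds in \<open>auto simp: f_def\<close>)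
  have map_eq: "map f xs = map f P @ 0 # map f Q" by (simp add: PQ(1) f0)
  have above: "Suc b \<le> f x" if "x \<in> set P" for x
    using b(2)[OF that] by (simp add: f_def)
  have "evil_free (b # map f P @ 0 # map f Q)"
  proof (rule evil_free_Cons_below_min)
    show "evil_free (map f P @ 0 # map f Q)" "distinct (map f P @ 0 # map f Q)"
      using ef_f dist_f unfolding map_eq .
    then show "0 < x" if "x \<in> set (map f P) \<union> set (map f Q)" for x
      using that by (metis Un_iff disjoint_iff distinct.simps(2) distinct_append gr0I list.set_intros(1))
    show "Suc b \<in> set (map f P)" using b(1) by (force simp: f_def)
  qed (use b_bounds above in auto)
  then have "evil_free (b # map f xs)" by (simp add: map_eq)
  then have "b # map f xs \<in> evil_free_words {..<Suc n}"
    using dist_f not_b set set_f unfolding evil_free_words_def by auto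
  moreover have "\<forall>x\<in>set (map f P). b < x" using above by (auto simp: Suc_le_eq)
  ultimately show ?thesis
    unfolding rising_words_def eq map_eq using PQ(2,3) by blast
qed

lemma rising_words_prepend_below:
  assumes "xs \<in> rising_words (Suc n)"
  shows "xs \<in> prepend_below ` interior_words n"
proof -
  from assms obtain a P Q where PQ: "xs = a # P @ 0 # Q" "P \<noteq> []" "Q \<noteq> []" "\<And>x. x \<in> set P \<Longrightarrow> a < x"
    and dist: "distinct xs" and set: "set xs = {..<Suc n}" and ef: "evil_free xs"
    unfolding rising_words_def evil_free_words_def by blast
  \<comment> \<open>Closes the hole left by the deleted letter \<open>a\<close>. It merges
    \<open>a\<close> and \<open>Suc a\<close>, so strict monotonicity relies on \<open>a\<close> not
    occurring in the rest.\<close>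
  define g where "g = (\<lambda>x. if x \<le> a then x else x - 1)"
  have pos: "0 < x" if "x \<in> set (a # P) \<union> set Q" for x
    using that dist unfolding PQ(1)
    by (auto intro!: gr0I)
  have gap: "gap_open (a # P) Q"
    using ef evil_free_insert_min[of "a # P" Q 0] pos unfolding PQ(1) by simp
  \<comment> \<open>If \<open>Suc a\<close> were in \<open>Q\<close>, then \<open>a\<close>, a
    letter \<open>b > Suc a\<close> of \<open>P\<close>, \<open>0\<close> and \<open>Suc a\<close>
    would form a 2413. Hence the renumbered block has minimum \<open>a\<close>, and
    \<open>prepend_below\<close> recovers the deleted letter.\<close>
  have Suc_a: "Suc a \<in> set P"
  proof (rule ccontr)
    assume neg: "Suc a \<notin> set P"
    define b where "b = Min (set P)"
    have b: "b \<in> set P" using PQ(2) by (simp add: b_def)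
    then have "Suc a < b" using PQ(4)[OF b] neg by (metis Suc_lessI)
    moreover have "b < Suc n" using b set PQ(1) by auto
    ultimately have "Suc a \<in> set xs" using set by auto
    then have "Suc a \<in> set Q" using neg PQ(1) by auto
    moreover have "subseq [a, b] (a # P)" using b by (simp add: subseq_singleton_left)
    ultimately show False
      using gap_openD(1)[OF gap, of a b "Suc a"] \<open>Suc a < b\<close> by simp
  qed
  define ys where "ys = map g (P @ 0 # Q)"
  have mono: "strict_mono_on (set (P @ 0 # Q)) g"
  proof (rule strict_mono_onI)
    fix r s assume "r \<in> set (P @ 0 # Q)" "s \<in> set (P @ 0 # Q)" "r < s"
    moreover from this have "r \<noteq> a" using dist unfolding PQ(1) by (metis distinct.simps(2))
    ultimately show "g r < g s" by (auto simp: g_def)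
  qed
  have g0: "g 0 = 0" by (simp add: g_def)
  have gP: "a \<le> g x" if "x \<in> set P" for x using PQ(4)[OF that] by (simp add: g_def)
  have "takeWhile (\<lambda>x. x \<noteq> 0) ys = map g P"
  proof -
    have "0 \<notin> set (map g P)"
      using gP pos[of a] by fastforce
    moreover have "ys = map g P @ 0 # map g Q" by (simp add: ys_def g0)
    ultimately show ?thesis using takeWhile_nonzero by blast
  qed
  moreover have "Min (set (map g P)) = a"
    by (rule Min_eqI) (use gP Suc_a in \<open>force simp: g_def\<close>)+
  moreover have "map (\<lambda>x. if x < a then x else Suc x) ys = P @ 0 # Q"
    unfolding ys_def map_map
    by (rule map_idI) (use dist PQ(1) in \<open>auto simp: g_def\<close>)
  ultimately have eq: "prepend_below ys = xs"
    by (simp add: prepend_below_def PQ(1))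
  have "a < Suc n" using set PQ(1) by auto
  have "set (P @ 0 # Q) = {..<Suc n} - {a}"
    using set dist unfolding PQ(1) by auto
  moreover have "g ` ({..<Suc n} - {a}) = {..<n}"
  proof (intro set_eqI iffI)
    fix x assume "x \<in> {..<n}"
    then have "x = g (if x < a then x else Suc x)" "(if x < a then x else Suc x) \<in> {..<Suc n} - {a}"
      by (auto simp: g_def)
    then show "x \<in> g ` ({..<Suc n} - {a})" by blast
  qed (use \<open>a < Suc n\<close> in \<open>auto simp: g_def split: if_splits\<close>)
  ultimately have "set ys = {..<n}" unfolding ys_def by (simp only: set_map)
  moreover have "distinct ys"
    unfolding ys_def distinct_map using dist strict_mono_on_imp_inj_on[OF mono] PQ(1) by simp
  moreover have "evil_free ys"
  proof -
    have "subseq (P @ 0 # Q) xs" unfolding PQ(1) by (intro list_emb_Cons) simp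
    then have "evil_free (P @ 0 # Q)" using ef evil_free_subseq by blast
    then show ?thesis unfolding ys_def by (simp only: evil_free_map[OF mono])
  qed
  moreover have "ys = map g P @ 0 # map g Q" by (simp add: ys_def g0)
  ultimately have "ys \<in> interior_words n"
    unfolding interior_words_def evil_free_words_def using PQ(2,3) by blast
  then show ?thesis using eq by blast
qed

lemma card_rising_words: "card (rising_words (Suc n)) = card (interior_words n)"
proof -
  have "rising_words (Suc n) = prepend_below ` interior_words n"
    using prepend_below_interior_words rising_words_prepend_below by blast
  then show ?thesis
    using inj_prepend_below by (simp add: card_image inj_on_subset)
qed

text \<open>With the overview's notation, \<open>x\<^sub>n\<^sub>+\<^sub>2 =
  x\<^sub>n\<^sub>+\<^sub>1 + a\<^sub>n\<^sub>+\<^sub>1\<close>; the splitting formula, used at two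
  successive lengths, eliminates both \<open>x\<close> terms.\<close>

lemma card_evil_free_words_rec:
  "card (evil_free_words {..<Suc (Suc n)}) + 2 * card (evil_free_words {..<n})
     = 4 * card (evil_free_words {..<Suc n})"
  and card_evil_free_words_base:
  "card (evil_free_words {..<0}) = 1" "card (evil_free_words {..<Suc 0}) = 1"
proof -
  \<comment> \<open>An interior word has at least three letters.\<close>
  have no_interior: "interior_words (Suc n) = {}" if "n \<le> 1" for n
  proof -
    have False if "P @ 0 # Q \<in> evil_free_words {..<Suc n}" "P \<noteq> []" "Q \<noteq> []" for P Q
    proof -
      have "length (P @ 0 # Q) = Suc n"
        using that(1) distinct_card[of "P @ 0 # Q"] by (simp only: evil_free_words_def mem_Collect_eq card_lessThan)
      moreover have "length P > 0" "length Q > 0" using that(2,3) by auto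
      ultimately show False using \<open>n \<le> 1\<close> by simp
    qed
    then show ?thesis unfolding interior_words_def by blast
  qed
  show base0: "card (evil_free_words {..<0}) = 1"
  proof -
    have "evil_free_words {..<0} = {[]}"
      by (auto simp: evil_free_words_def evil_free_def)
    then show ?thesis by simp
  qed
  show base1: "card (evil_free_words {..<Suc 0}) = 1"
  proof -
    have "evil_free_words {..<Suc 0} = {[0]}"
    proof (intro set_eqI iffI)
      fix xs assume "xs \<in> evil_free_words {..<Suc 0}"
      then have "distinct xs" "set xs = {0}" by (auto simp: evil_free_words_def lessThan_Suc)
      then show "xs \<in> {[0]}"
        by (cases xs) (auto simp: subset_singleton_iff)
    qed (auto simp: evil_free_words_def evil_free_def)
    then show ?thesis by simp
  qed
  show "card (evil_free_words {..<Suc (Suc n)}) + 2 * card (evil_free_words {..<n})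
     = 4 * card (evil_free_words {..<Suc n})"
  \<comment> \<open>For \<open>n = 0\<close> the splitting formula is available only at the greater
    length, where there are no interior words.\<close>
  proof (cases "n = 0")
    case True
    then show ?thesis
      using card_evil_free_words_split[of 1] no_interior[of 1] base0 base1 by simp
  next
    case False
    then have "card (interior_words (Suc (Suc n)))
        = card (interior_words (Suc n)) + card (evil_free_words {..<Suc n})"
      using card_interior_words_split[of "Suc (Suc n)"] card_rising_words[of "Suc n"]
        card_falling_words[of "Suc n"] by simp
    then show ?thesis
      using card_evil_free_words_split[of n] card_evil_free_words_split[of "Suc n"] False by simp
  qed
qed

lemma card_evil_free_words_eq:
  "card (evil_free_words {..<n}) = card (almost_increasing_perms n)"
proof (induction n rule: less_induct)
  case (less n)
  consider "n = 0" | "n = Suc 0" | m where "n = Suc (Suc m)"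
    by (metis not0_implies_Suc)
  then show ?case
  proof cases
    case 3
    then show ?thesis
      using card_evil_free_words_rec[of m] card_almost_increasing_perms_rec[of m]
        less[of m] less[of "Suc m"] by simp
  qed (simp_all only: card_evil_free_words_base card_almost_increasing_perms_base)
qed

section \<open>Permutations as words\<close>

lemma sorted_wrt_subseq: "subseq xs ys \<Longrightarrow> sorted_wrt R ys \<Longrightarrow> sorted_wrt R xs"
  by (induction rule: list_emb.induct) (auto dest: subseq_set)

text \<open>Increasing index tuples in \<open>{1..n}\<close> are the subsequences of
  \<open>[1..<Suc n]\<close>, and \<open>map p\<close> carries these to subsequences of the one-line
  form.\<close>

lemma contains_pattern_iff_subseq:
  "contains_pattern n p pat \<longleftrightarrow>
     (\<exists>ys. subseq ys (map p [1..<Suc n]) \<and> length ys = length pat \<and>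
        (\<forall>a<length pat. \<forall>b<length pat. ys ! a < ys ! b \<longleftrightarrow> pat ! a < pat ! b))"
proof
  assume "contains_pattern n p pat"
  then obtain idx where idx: "strict_mono_on {..<length pat} idx" "idx ` {..<length pat} \<subseteq> {1..n}"
    "\<forall>a<length pat. \<forall>b<length pat. p (idx a) < p (idx b) \<longleftrightarrow> pat ! a < pat ! b"
    unfolding contains_pattern_def by blast
  define zs where "zs = map idx [0..<length pat]"
  have "sorted_wrt (<) zs"
    using idx(1) by (auto simp: zs_def sorted_wrt_iff_nth_less strict_mono_on_def)
  moreover have "set zs \<subseteq> set [1..<Suc n]"
    using idx(2) by (auto simp: zs_def atLeast0LessThan)
  ultimately have "subseq (map p zs) (map p [1..<Suc n])"
    by (intro subseq_map sorted_subset_imp_subseq sorted_upt)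
  then show "\<exists>ys. subseq ys (map p [1..<Suc n]) \<and> length ys = length pat \<and>
        (\<forall>a<length pat. \<forall>b<length pat. ys ! a < ys ! b \<longleftrightarrow> pat ! a < pat ! b)"
    using idx(3) by (intro exI[of _ "map p zs"]) (simp add: zs_def)
next
  assume "\<exists>ys. subseq ys (map p [1..<Suc n]) \<and> length ys = length pat \<and>
        (\<forall>a<length pat. \<forall>b<length pat. ys ! a < ys ! b \<longleftrightarrow> pat ! a < pat ! b)"
  then obtain zs where zs: "subseq zs [1..<Suc n]" "length zs = length pat"
    "\<forall>a<length pat. \<forall>b<length pat. p (zs ! a) < p (zs ! b) \<longleftrightarrow> pat ! a < pat ! b"
    unfolding subseq_map_conv by force
  have "sorted_wrt (<) zs"
    using zs(1) sorted_wrt_upt by (rule sorted_wrt_subseq)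
  then have "strict_mono_on {..<length pat} (\<lambda>i. zs ! i)"
    using zs(2) by (intro strict_mono_onI) (auto simp: sorted_wrt_iff_nth_less)
  moreover have "(\<lambda>i. zs ! i) ` {..<length pat} \<subseteq> {1..n}"
  proof -
    have "zs ! i \<in> {1..n}" if "i < length pat" for i
    proof -
      have "zs ! i \<in> set [1..<Suc n]"
        using that zs(2) subseq_set[OF zs(1)] nth_mem[of i zs] by (metis subsetD)
      then show ?thesis by auto
    qed
    then show ?thesis by blast
  qed
  ultimately show "contains_pattern n p pat"
    unfolding contains_pattern_def using zs(3) by blast
qed

lemma contains_pattern4_iff:
  "contains_pattern n p [i, j, k, l] \<longleftrightarrow>
     (\<exists>a b c d. subseq [a, b, c, d] (map p [1..<Suc n]) \<and>
        (\<forall>s<4. \<forall>t<4. [a, b, c, d] ! s < [a, b, c, d] ! t \<longleftrightarrow> [i, j, k, l] ! s < [i, j, k, l] ! t))"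
proof -
  have len: "length [i, j, k, l] = 4" by simp
  have len4: "length ys = 4 \<longleftrightarrow> (\<exists>a b c d. ys = [a, b, c, d])" for ys :: "nat list"
    by (auto simp: numeral_eq_Suc length_Suc_conv)
  show ?thesis
    unfolding contains_pattern_iff_subseq len len4 by blast
qed

lemma all_less_4: "(\<forall>s<4. Q s) \<longleftrightarrow> Q 0 \<and> Q 1 \<and> Q 2 \<and> Q (3::nat)"
  by (auto simp: numeral_eq_Suc less_Suc_eq)

lemma evil_avoiding_iff_evil_free: "evil_avoiding n p \<longleftrightarrow> evil_free (map p [1..<Suc n])"
proof -
  have patterns: "(\<forall>s<4. \<forall>t<4. [a, b, c, d] ! s < [a, b, c, d] ! t \<longleftrightarrow> [2, 4, 1, 3] ! s < [2, 4, 1, 3::nat] ! t)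
      \<longleftrightarrow> c < a \<and> a < d \<and> d < b"
    "(\<forall>s<4. \<forall>t<4. [a, b, c, d] ! s < [a, b, c, d] ! t \<longleftrightarrow> [4, 1, 3, 2] ! s < [4, 1, 3, 2::nat] ! t)
      \<longleftrightarrow> b < d \<and> d < c \<and> c < a"
    "(\<forall>s<4. \<forall>t<4. [a, b, c, d] ! s < [a, b, c, d] ! t \<longleftrightarrow> [4, 2, 1, 3] ! s < [4, 2, 1, 3::nat] ! t)
      \<longleftrightarrow> c < b \<and> b < d \<and> d < a"
    "(\<forall>s<4. \<forall>t<4. [a, b, c, d] ! s < [a, b, c, d] ! t \<longleftrightarrow> [3, 2, 1, 4] ! s < [3, 2, 1, 4::nat] ! t)
      \<longleftrightarrow> c < b \<and> b < a \<and> a < d"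
    for a b c d :: nat
    by (auto simp: all_less_4)
  show ?thesis
    unfolding evil_avoiding_def avoids_def evil_free_def evil_def contains_pattern4_iff patterns
    by blast
qed

lemma card_evil_avoiding_perms:
  "card {p \<in> perms n. evil_avoiding n p} = card (evil_free_words {1..n})"
proof (rule bij_betw_same_card[of "\<lambda>p. map p [1..<Suc n]"], rule bij_betwI')
  fix p q assume "p \<in> {p \<in> perms n. evil_avoiding n p}" "q \<in> {p \<in> perms n. evil_avoiding n p}"
  then have pq: "p permutes {1..n}" "q permutes {1..n}" by (auto simp: perms_def)
  show "map p [1..<Suc n] = map q [1..<Suc n] \<longleftrightarrow> p = q"
  proof
    assume eq: "map p [1..<Suc n] = map q [1..<Suc n]"
    show "p = q"
    proof
      fix x
      show "p x = q x"
      proof (cases "x \<in> {1..n}")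
        case True
        then have "x \<in> set [1..<Suc n]" by auto
        then show ?thesis using eq by (metis map_eq_conv)
      next
        case False
        then show ?thesis using pq by (simp add: permutes_not_in)
      qed
    qed
  qed simp
next
  fix p assume "p \<in> {p \<in> perms n. evil_avoiding n p}"
  then have p: "p permutes {1..n}" "evil_avoiding n p" by (auto simp: perms_def)
  have S: "set [1..<Suc n] = {1..n}" by auto
  have "distinct (map p [1..<Suc n])"
    using permutes_inj[OF p(1)] by (simp add: distinct_map inj_on_def inj_def)
  moreover have "set (map p [1..<Suc n]) = {1..n}"
    unfolding set_map S by (rule permutes_image[OF p(1)])
  moreover have "evil_free (map p [1..<Suc n])"
    using p(2) by (simp only: evil_avoiding_iff_evil_free)
  ultimately show "map p [1..<Suc n] \<in> evil_free_words {1..n}"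
    unfolding evil_free_words_def by blast
next
  fix xs assume "xs \<in> evil_free_words {1..n}"
  then have xs: "distinct xs" "set xs = {1..n}" "evil_free xs" by (auto simp: evil_free_words_def)
  then have len: "length xs = n" using distinct_card by fastforce
  \<comment> \<open>Lists are indexed from 0, hence \<open>i - 1\<close>; outside
    \<open>{1..n}\<close> a permutation has to be the identity.\<close>
  define p where "p = (\<lambda>i. if i \<in> {1..n} then xs ! (i - 1) else i)"
  have map_p: "map p [1..<Suc n] = xs"
    by (rule nth_equalityI) (auto simp: p_def len simp del: upt_Suc)
  have S: "set [1..<Suc n] = {1..n}" by auto
  have "p ` {1..n} = {1..n}"
    using xs(2) unfolding map_p[symmetric] set_map S .
  moreover have "inj_on p {1..n}"
    using xs(1) unfolding map_p[symmetric] distinct_map S by blast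
  ultimately have "p permutes {1..n}"
    by (intro bij_imp_permutes) (auto simp: bij_betw_def p_def)
  moreover have "evil_avoiding n p"
    unfolding evil_avoiding_iff_evil_free map_p by (rule xs(3))
  ultimately show "\<exists>p\<in>{p \<in> perms n. evil_avoiding n p}. xs = map p [1..<Suc n]"
    using map_p by (intro bexI[of _ p]) (auto simp: perms_def)
qed

theorem theorem7p3:
  fixes n :: nat
  assumes "n \<ge> 1"
  shows "card {p \<in> perms n. one_almost_increasing n p} = card {p \<in> perms n. evil_avoiding n p}"
  using card_evil_avoiding_perms card_evil_free_words_Suc card_evil_free_words_eq
  unfolding almost_increasing_perms_def by simp

end
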